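(* Let $\Omega$ be a bounded domain in $\mathbb{H}$ and $f\in C(\Omega)$. Let $u\in USC(\overline{\Omega})$ and $v\in LSC(\overline{\Omega})$ be respectively a subsolution and a supersolution of $$u(p)+H(p,u(p),\nabla_Hu(p))=f(p)\quad\text{in }\Omega.$$ Assume in addition that, for some $K\in\mathbb{R}$, $u\le v=K$ on $\partial\Omega$ and $u\le K$ in $\overline{\Omega}$. Then $u\le v$ in $\overline{\Omega}$.
   Context: The Heisenberg group $\mathbb{H}$ is $\mathbb{R}^3$ (with its usual topology) with the group law $(x_p,y_p,z_p)\cdot(x_q,y_q,z_q)=(x_p+x_q,\,y_p+y_q,\,z_p+z_q+\frac12(x_py_q-x_qy_p))$. Let $\mathbb{H}_0=\{(x,y,0):x,y\in\mathbb{R}\}$ and, for $p\in\mathbb{H}$, $\mathbb{H}_p=\{p\cdot h:h\in\mathbb{H}_0\}$. For $\zeta=(x,y,z)\in\mathbb{H}$ write $\zeta_h=(x,y)$. With $X_1=\partial_x-\frac y2\partial_z$ and $X_2=\partial_y+\frac x2\partial_z$, the horizontal gradient is $\nabla_H\varphi=(X_1\varphi,X_2\varphi)$. A domain is a connected open set. $USC$ / $LSC$ denote upper / lower semicontinuous functions. For $u:\Omega\to\mathbb{R}$ and $p\in\Omega$ put $S_p(u)=\{\xi\in\mathbb{H}_p\cap\Omega:u(\xi)<u(p)\}$ and $\hat S_p(u)=\{\xi\in\mathbb{H}_p\cap\Omega:u(\xi)\le u(p)\}$. The equation $u+H(p,u,\nabla_Hu)=f$ in $\Omega$ is understood as follows.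 Subsolution ($f\in USC(\Omega)$ locally bounded): a locally bounded $u\in USC(\Omega)$ such that whenever $p\in\Omega$ and $\varphi\in C^1(\Omega)$ are such that $u-\varphi$ attains a maximum at $p$, one has $u(p)+\sup\{\langle\nabla_H\varphi(p),(p^{-1}\cdot\xi)_h\rangle:\xi\in S_p(u)\}\le f(p)$, the supremum being taken as $0$ if $\nabla_H\varphi(p)=0$. Supersolution ($f\in LSC(\Omega)$ locally bounded): a locally bounded $u\in LSC(\Omega)$ such that whenever $p\in\Omega$ and $\varphi\in C^1(\Omega)$ are such that $u-\varphi$ attains a minimum at $p$, one has $u(p)+\sup\{\langle\nabla_H\varphi(p),(p^{-1}\cdot\xi)_h\rangle:\xi\in\hat S_p(u)\}\ge f(p)$. *)

theory Defs
  imports "HOL-Analysis.Analysis"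
begin

section \<open>The Heisenberg group\<close>

type_synonym heis = "real \<times> real \<times> real"

fun hmul :: "heis \<Rightarrow> heis \<Rightarrow> heis"  (infixl \<open>\<cdot>\<^sub>H\<close> 70) where
  "(x, y, z) \<cdot>\<^sub>H (x', y', z') = (x + x', y + y', z + z' + (x * y' - x' * y) / 2)"

fun hinv :: "heis \<Rightarrow> heis" where
  "hinv (x, y, z) = (- x, - y, - z)"

lemma hmul_assoc: "(p \<cdot>\<^sub>H q) \<cdot>\<^sub>H r = p \<cdot>\<^sub>H (q \<cdot>\<^sub>H r)"
  by (cases p; cases q; cases r) (simp add: field_simps)

lemma hmul_zero [simp]: "0 \<cdot>\<^sub>H p = p" "p \<cdot>\<^sub>H 0 = p"
  by (cases p; simp add: zero_prod_def)+

lemma hmul_hinv [simp]: "hinv p \<cdot>\<^sub>H p = 0" "p \<cdot>\<^sub>H hinv p = 0"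
  by (cases p; simp add: zero_prod_def)+

fun hpart :: "heis \<Rightarrow> real \<times> real" where
  "hpart (x, y, z) = (x, y)"

definition hplane0 :: "heis set" where
  "hplane0 = {(x, y, 0) | x y. True}"

definition hplane :: "heis \<Rightarrow> heis set" where
  "hplane p = (\<lambda>h. p \<cdot>\<^sub>H h) ` hplane0"

text \<open>The partial derivatives in the vector fields are those of the slices of \<open>\<phi>\<close> along the
  coordinate axes; only the values of \<open>\<phi>\<close> near the point matter.\<close>

fun X1 :: "(heis \<Rightarrow> real) \<Rightarrow> heis \<Rightarrow> real" where
  "X1 \<phi> (x, y, z) = deriv (\<lambda>t. \<phi> (t, y, z)) x - y / 2 * deriv (\<lambda>t. \<phi> (x, y, t)) z"

fun X2 :: "(heis \<Rightarrow> real) \<Rightarrow> heis \<Rightarrow> real" where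
  "X2 \<phi> (x, y, z) = deriv (\<lambda>t. \<phi> (x, t, z)) y + x / 2 * deriv (\<lambda>t. \<phi> (x, y, t)) z"

definition hgrad :: "(heis \<Rightarrow> real) \<Rightarrow> heis \<Rightarrow> real \<times> real" where
  "hgrad \<phi> p = (X1 \<phi> p, X2 \<phi> p)"


section \<open>Function classes\<close>

text \<open>Functions on a set \<open>S\<close> are represented by total functions, of which only the
  values on \<open>S\<close> are used.\<close>

definition usc_on :: "'a::topological_space set \<Rightarrow> ('a \<Rightarrow> real) \<Rightarrow> bool" where
  "usc_on S u \<longleftrightarrow> (\<forall>p\<in>S. \<forall>c>u p. eventually (\<lambda>q. u q < c) (at p within S))"

definition lsc_on :: "'a::topological_space set \<Rightarrow> ('a \<Rightarrow> real) \<Rightarrow> bool" where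
  "lsc_on S u \<longleftrightarrow> (\<forall>p\<in>S. \<forall>c<u p. eventually (\<lambda>q. c < u q) (at p within S))"

definition locally_bounded_on :: "'a::topological_space set \<Rightarrow> ('a \<Rightarrow> real) \<Rightarrow> bool" where
  "locally_bounded_on S u \<longleftrightarrow> (\<forall>p\<in>S. \<exists>U. open U \<and> p \<in> U \<and> bounded (u ` (U \<inter> S)))"

text \<open>Intended for open sets only.\<close>

definition C1_on :: "'a::real_normed_vector set \<Rightarrow> ('a \<Rightarrow> real) \<Rightarrow> bool" where
  "C1_on S \<phi> \<longleftrightarrow>
    (\<exists>D :: 'a \<Rightarrow> 'a \<Rightarrow>\<^sub>L real.
      (\<forall>p\<in>S. (\<phi> has_derivative blinfun_apply (D p)) (at p)) \<and> continuous_on S D)"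


section \<open>Sub- and supersolutions of \<open>u + H(p, u, \<nabla>\<^sub>H u) = f\<close>\<close>

definition sublevel_strict :: "heis set \<Rightarrow> (heis \<Rightarrow> real) \<Rightarrow> heis \<Rightarrow> heis set" where
  "sublevel_strict \<Omega> u p = {\<xi> \<in> hplane p \<inter> \<Omega>. u \<xi> < u p}"

definition sublevel :: "heis set \<Rightarrow> (heis \<Rightarrow> real) \<Rightarrow> heis \<Rightarrow> heis set" where
  "sublevel \<Omega> u p = {\<xi> \<in> hplane p \<inter> \<Omega>. u \<xi> \<le> u p}"

text \<open>The suprema are taken in the extended reals, because they may be \<open>\<infinity>\<close> when \<open>\<Omega>\<close> is
  unbounded. The convention \<open>Sup {} = - \<infinity>\<close> plays no role: if \<open>u - \<phi>\<close> has a maximum at \<open>p\<close> and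
  the horizontal gradient of \<open>\<phi>\<close> at \<open>p\<close> is nonzero, then \<open>u\<close> has values below \<open>u p\<close> on the
  horizontal plane arbitrarily near \<open>p\<close>, and \<open>p\<close> itself always lies in the non-strict
  sublevel set.\<close>

definition subsolution :: "heis set \<Rightarrow> (heis \<Rightarrow> real) \<Rightarrow> (heis \<Rightarrow> real) \<Rightarrow> bool" where
  "subsolution \<Omega> f u \<longleftrightarrow>
    usc_on \<Omega> f \<and> locally_bounded_on \<Omega> f \<and> usc_on \<Omega> u \<and> locally_bounded_on \<Omega> u \<and>
    (\<forall>p\<in>\<Omega>. \<forall>\<phi>. C1_on \<Omega> \<phi> \<and> (\<forall>q\<in>\<Omega>. u q - \<phi> q \<le> u p - \<phi> p) \<longrightarrow>
      ereal (u p) +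
        (if hgrad \<phi> p = 0 then 0
         else SUP \<xi>\<in>sublevel_strict \<Omega> u p. ereal (hgrad \<phi> p \<bullet> hpart (hinv p \<cdot>\<^sub>H \<xi>)))
      \<le> ereal (f p))"

definition supersolution :: "heis set \<Rightarrow> (heis \<Rightarrow> real) \<Rightarrow> (heis \<Rightarrow> real) \<Rightarrow> bool" where
  "supersolution \<Omega> f u \<longleftrightarrow>
    lsc_on \<Omega> f \<and> locally_bounded_on \<Omega> f \<and> lsc_on \<Omega> u \<and> locally_bounded_on \<Omega> u \<and>
    (\<forall>p\<in>\<Omega>. \<forall>\<phi>. C1_on \<Omega> \<phi> \<and> (\<forall>q\<in>\<Omega>. u p - \<phi> p \<le> u q - \<phi> q) \<longrightarrow>
      ereal (f p) \<le>
        ereal (u p) +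
        (SUP \<xi>\<in>sublevel \<Omega> u p. ereal (hgrad \<phi> p \<bullet> hpart (hinv p \<cdot>\<^sub>H \<xi>))))"

end

theory Submission
  imports Defs
begin

text \<open>Variables are doubled with the right-invariant penalty \<open>n |p q\<inverse>|\<^sup>2\<close>. It is unchanged under
  \<open>(p, q) \<mapsto> (p h, q h)\<close>, and its horizontal gradients in \<open>p\<close> and (with opposite sign) in \<open>q\<close> are the
  same vector \<open>a\<close>. Hence, at a maximum \<open>(p, q)\<close> of \<open>u(p) - v(q) - n |p q\<inverse>|\<^sup>2\<close>, a point \<open>q h\<close> with
  \<open>v(q h) \<le> v(q)\<close> yields \<open>u(p h) \<le> u(p)\<close>; when \<open>\<langle>a, h\<rangle> > 0\<close>, shrinking \<open>h\<close> slightly decreases the penalty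
  and makes this inequality strict, so the subsolution test at \<open>p\<close> controls the supersolution test
  at \<open>q\<close>. When \<open>\<langle>a, h\<rangle> \<le> 0\<close>, moving from \<open>p\<close> slightly along \<open>-a\<close> gives \<open>u(p) \<le> f(p)\<close>, which suffices.
  The boundary conditions confine \<open>{v \<le> v(q)}\<close> to a compact subset of \<open>\<Omega>\<close>, so \<open>p h\<close> stays in \<open>\<Omega>\<close>.\<close>

section \<open>Semicontinuous functions on compact sets\<close>

text \<open>At \<open>q = p\<close> the bound \<open>u q < c\<close> is just \<open>u p < c\<close>,
  so the punctured filter can be replaced by \<open>nhds p\<close>. This form composes with
  arbitrary limits, including sequences that hit \<open>p\<close>.\<close>

lemma usc_on_nhds_iff:
  "usc_on S u \<longleftrightarrow> (\<forall>p\<in>S. \<forall>c>u p. eventually (\<lambda>q. q \<in> S \<longrightarrow> u q < c) (nhds p))"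
proof -
  have "eventually (\<lambda>q. u q < c) (at p within S) \<longleftrightarrow> eventually (\<lambda>q. q \<in> S \<longrightarrow> u q < c) (nhds p)"
    if "u p < c" for p c
    unfolding eventually_at_filter using that
    by (intro eventually_subst always_eventually) auto
  then show ?thesis unfolding usc_on_def by blast
qed

lemma lsc_on_iff_usc_on_uminus: "lsc_on S v \<longleftrightarrow> usc_on S (\<lambda>p. - v p)"
proof -
  have "(\<forall>c>- v p. eventually (\<lambda>q. - v q < c) F) \<longleftrightarrow> (\<forall>c<v p. eventually (\<lambda>q. c < v q) F)"
    for p and F :: "'a filter"
  proof safe
    fix c assume "\<forall>c>- v p. eventually (\<lambda>q. - v q < c) F" "c < v p"
    from this(1)[rule_format, of "- c"] this(2) show "eventually (\<lambda>q. c < v q) F" by simp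
  next
    fix c assume "\<forall>c<v p. eventually (\<lambda>q. c < v q) F" "- v p < c"
    from this(1)[rule_format, of "- c"] this(2) show "eventually (\<lambda>q. - v q < c) F"
      by (simp add: minus_less_iff)
  qed
  then show ?thesis unfolding lsc_on_def usc_on_def by simp
qed

lemma usc_on_filterlim:
  assumes "usc_on S u" "p \<in> S" "u p < c" "filterlim X (nhds p) F" "eventually (\<lambda>n. X n \<in> S) F"
  shows "eventually (\<lambda>n. u (X n) < c) F"
proof -
  have "eventually (\<lambda>q. q \<in> S \<longrightarrow> u q < c) (nhds p)"
    using assms unfolding usc_on_nhds_iff by blast
  then have "eventually (\<lambda>n. X n \<in> S \<longrightarrow> u (X n) < c) F"
    using assms(4) by (rule eventually_compose_filterlim)
  with assms(5) show ?thesis by eventually_elim simp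
qed

text \<open>Without a maximum, every \<open>p\<close> has some \<open>m p\<close> in
  \<open>S\<close> with a larger value, and \<open>u\<close> stays below \<open>u (m p)\<close> near
  \<open>p\<close>. In a finite subcover by such neighbourhoods, the point with the largest value
  \<open>u (m p)\<close> lies in one of them, which is absurd.\<close>

lemma usc_on_attains_max:
  assumes S: "compact S" "S \<noteq> {}" and u: "usc_on S u"
  shows "\<exists>p\<in>S. \<forall>q\<in>S. u q \<le> u p"
proof (rule ccontr)
  assume "\<not> ?thesis"
  then have "\<forall>p\<in>S. \<exists>q\<in>S. u p < u q" by (meson not_le)
  then obtain m where m: "\<And>p. p \<in> S \<Longrightarrow> m p \<in> S \<and> u p < u (m p)" by metis
  have "\<exists>U. open U \<and> p \<in> U \<and> (\<forall>q\<in>U. q \<in> S \<longrightarrow> u q < u (m p))" if "p \<in> S" for p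
    using u m[OF that] that unfolding usc_on_nhds_iff eventually_nhds by blast
  then obtain U where U: "\<And>p. p \<in> S \<Longrightarrow> open (U p) \<and> p \<in> U p \<and> (\<forall>q\<in>U p. q \<in> S \<longrightarrow> u q < u (m p))"
    by metis
  obtain F where F: "F \<subseteq> S" "finite F" "S \<subseteq> (\<Union>p\<in>F. U p)"
    using compactE_image[OF S(1), of S U] U by blast
  have fin: "finite ((\<lambda>p. u (m p)) ` F)" "(\<lambda>p. u (m p)) ` F \<noteq> {}" using F S by auto
  from Max_in[OF this] obtain p where p: "p \<in> F" "u (m p) = Max ((\<lambda>p. u (m p)) ` F)"
    by auto
  have "m p \<in> S" using p F m by blast
  then obtain q where q: "q \<in> F" "m p \<in> U q" using F by blast
  then have "u (m p) < u (m q)" using U F \<open>m p \<in> S\<close> by blast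
  moreover have "u (m q) \<le> u (m p)" using p(2) q(1) fin by simp
  ultimately show False by simp
qed

lemma usc_on_diff_penalty:
  fixes g :: "'a::topological_space \<Rightarrow> 'b::topological_space \<Rightarrow> real"
  assumes u: "usc_on S u" and v: "lsc_on T v"
    and g: "continuous_on UNIV (\<lambda>x. g (fst x) (snd x))"
  shows "usc_on (S \<times> T) (\<lambda>x. u (fst x) - v (snd x) - g (fst x) (snd x))"
  unfolding usc_on_nhds_iff
proof (intro ballI allI impI)
  fix x c assume x: "x \<in> S \<times> T" and c: "u (fst x) - v (snd x) - g (fst x) (snd x) < c"
  \<comment> \<open>A third of the gap, one share for each of \<open>u\<close>, \<open>v\<close> and
    \<open>g\<close>.\<close>
  define e where "e = (c - (u (fst x) - v (snd x) - g (fst x) (snd x))) / 3"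
  have e: "e > 0" using c by (simp add: e_def)
  have fs: "fst x \<in> S" "snd x \<in> T" using x by auto
  have "eventually (\<lambda>p. p \<in> S \<longrightarrow> u p < u (fst x) + e) (nhds (fst x))"
    using u fs e unfolding usc_on_nhds_iff by simp
  then have 1: "eventually (\<lambda>y. fst y \<in> S \<longrightarrow> u (fst y) < u (fst x) + e) (nhds x)"
    by (rule eventually_compose_filterlim) (intro tendsto_fst filterlim_ident)
  have "eventually (\<lambda>q. q \<in> T \<longrightarrow> - v q < - v (snd x) + e) (nhds (snd x))"
    using v fs e unfolding lsc_on_iff_usc_on_uminus usc_on_nhds_iff by simp
  then have 2: "eventually (\<lambda>y. snd y \<in> T \<longrightarrow> - v (snd y) < - v (snd x) + e) (nhds x)"
    by (rule eventually_compose_filterlim) (intro tendsto_snd filterlim_ident)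
  have "(\<lambda>y. g (fst y) (snd y)) \<midarrow>x\<rightarrow> g (fst x) (snd x)"
    using g unfolding continuous_on_def by blast
  then have "((\<lambda>y. g (fst y) (snd y)) \<longlongrightarrow> g (fst x) (snd x)) (nhds x)"
    by (simp only: tendsto_nhds_iff)
  then have 3: "eventually (\<lambda>y. g (fst x) (snd x) - e < g (fst y) (snd y)) (nhds x)"
    using e by (intro order_tendstoD(1)) auto
  from 1 2 3 show "eventually (\<lambda>y. y \<in> S \<times> T \<longrightarrow>
      u (fst y) - v (snd y) - g (fst y) (snd y) < c) (nhds x)"
  proof eventually_elim
    case (elim y)
    have "3 * e = c - (u (fst x) - v (snd x) - g (fst x) (snd x))" by (simp add: e_def)
    moreover have "u (fst y) < u (fst x) + e" "- v (snd y) < - v (snd x) + e" if "y \<in> S \<times> T"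
      using elim that by auto
    ultimately show ?case using elim(3) by fastforce
  qed
qed

section \<open>The right-invariant penalty\<close>

text \<open>The norm is the Euclidean one, so its square is a polynomial in the coordinates and can
  serve as a test function.\<close>

definition rpen :: "heis \<Rightarrow> heis \<Rightarrow> real" where
  "rpen p q = (norm (p \<cdot>\<^sub>H hinv q))\<^sup>2"

lemma rpen_eq:
  "rpen (x, y, z) (a, b, c) = (x - a)\<^sup>2 + (y - b)\<^sup>2 + (z - c + (a * y - x * b) / 2)\<^sup>2"
  by (simp add: rpen_def norm_Pair add.assoc diff_divide_distrib algebra_simps)

lemma rpen_refl [simp]: "rpen p p = 0"
  by (simp add: rpen_def)

lemma continuous_on_hmul [continuous_intros]:
  assumes "continuous_on S f" "continuous_on S g"
  shows "continuous_on S (\<lambda>x. f x \<cdot>\<^sub>H g x)"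
proof -
  have "f x \<cdot>\<^sub>H g x = (fst (f x) + fst (g x), fst (snd (f x)) + fst (snd (g x)),
      snd (snd (f x)) + snd (snd (g x))
        + (fst (f x) * fst (snd (g x)) - fst (g x) * fst (snd (f x))) / 2)" for x
    by (cases "f x"; cases "g x") simp
  then show ?thesis using assms by (simp del: hmul.simps) (intro continuous_intros; simp)
qed

lemma continuous_on_hinv [continuous_intros]:
  assumes "continuous_on S f"
  shows "continuous_on S (\<lambda>x. hinv (f x))"
proof -
  have "hinv (f x) = - f x" for x
    by (cases "f x") simp
  then show ?thesis using assms by (simp add: continuous_on_minus)
qed

text \<open>\<open>D\<close> is a combination of three fixed coordinate functionals, so its
  continuity in operator norm reduces to that of the coefficients.\<close>

lemma C1_on_heisI:
  fixes \<phi> A B C :: "heis \<Rightarrow> real"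
  assumes d: "\<And>p. (\<phi> has_derivative (\<lambda>h. A p * fst h + B p * fst (snd h) + C p * snd (snd h))) (at p)"
    and c: "continuous_on UNIV A" "continuous_on UNIV B" "continuous_on UNIV C"
  shows "C1_on S \<phi>"
proof -
  define D :: "heis \<Rightarrow> heis \<Rightarrow>\<^sub>L real" where
    "D p = A p *\<^sub>R Blinfun fst + B p *\<^sub>R Blinfun (\<lambda>h. fst (snd h)) + C p *\<^sub>R Blinfun (\<lambda>h. snd (snd h))" for p
  have bl: "bounded_linear (fst :: heis \<Rightarrow> real)" "bounded_linear (\<lambda>h::heis. fst (snd h))"
      "bounded_linear (\<lambda>h::heis. snd (snd h))"
    by (intro bounded_linear_intros)+
  have "blinfun_apply (D p) = (\<lambda>h. A p * fst h + B p * fst (snd h) + C p * snd (snd h))" for p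
    by (rule ext) (simp add: D_def blinfun.add_left blinfun.scaleR_left bounded_linear_Blinfun_apply bl)
  moreover have "continuous_on UNIV D"
    unfolding D_def using c by (intro continuous_intros)
  ultimately show ?thesis
    unfolding C1_on_def using d by (intro exI[of _ D]) (auto intro: continuous_on_subset)
qed

section \<open>Regularity and horizontal gradients of the penalty\<close>

lemma C1_on_rpen_left: "C1_on S (\<lambda>p. n * rpen p q)"
proof -
  obtain a b c where q: "q = (a, b, c)" by (cases q)
  let ?w = "\<lambda>p::heis. snd (snd p) - c + (a * fst (snd p) - fst p * b) / 2"
  have e: "n * rpen p q = n * ((fst p - a)\<^sup>2 + (fst (snd p) - b)\<^sup>2 + (?w p)\<^sup>2)" for p
    by (cases p) (simp add: q rpen_eq)
  show ?thesis
    unfolding e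
    by (rule C1_on_heisI[where A = "\<lambda>p. n * (2 * (fst p - a) - b * ?w p)"
          and B = "\<lambda>p. n * (2 * (fst (snd p) - b) + a * ?w p)" and C = "\<lambda>p. n * (2 * ?w p)"])
      (auto intro!: derivative_eq_intros continuous_intros ext simp: field_simps)
qed

text \<open>The sign fits the supersolution test: at a penalized maximum,
  \<open>v q + n * rpen p q\<close> is minimal in \<open>q\<close>.\<close>

lemma C1_on_rpen_right: "C1_on S (\<lambda>q. - (n * rpen p q))"
proof -
  obtain x y z where p: "p = (x, y, z)" by (cases p)
  let ?w = "\<lambda>q::heis. z - snd (snd q) + (fst q * y - x * fst (snd q)) / 2"
  have e: "- (n * rpen p q) = - (n * ((x - fst q)\<^sup>2 + (y - fst (snd q))\<^sup>2 + (?w q)\<^sup>2))" for q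
    by (cases q) (simp add: p rpen_eq)
  show ?thesis
    unfolding e
    by (rule C1_on_heisI[where A = "\<lambda>q. n * (2 * (x - fst q) - y * ?w q)"
          and B = "\<lambda>q. n * (2 * (y - fst (snd q)) + x * ?w q)" and C = "\<lambda>q. n * (2 * ?w q)"])
      (auto intro!: derivative_eq_intros continuous_intros ext simp: field_simps)
qed

text \<open>\<open>w\<close> is the vertical coordinate of \<open>p \<cdot>\<^sub>H hinv q\<close>.
  For the variable \<open>p\<close>, the derivative in \<open>x\<close> contributes
  \<open>b * w\<close> and the vertical part of \<open>X1\<close> contributes \<open>y * w\<close>;
  for \<open>q\<close> the roles are exchanged, hence the symmetric \<open>y + b\<close>, and
  likewise \<open>x + a\<close>.\<close>

fun rpen_hgrad :: "heis \<Rightarrow> heis \<Rightarrow> real \<times> real" where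
  "rpen_hgrad (x, y, z) (a, b, c) =
    (let w = z - c + (a * y - x * b) / 2
     in (2 * (x - a) - (y + b) * w, 2 * (y - b) + (x + a) * w))"

lemma hgrad_rpen_left: "hgrad (\<lambda>p. n * rpen p q) p = n *\<^sub>R rpen_hgrad p q"
proof -
  obtain x y z a b c where pq: "p = (x, y, z)" "q = (a, b, c)" by (metis surj_pair)
  let ?w = "z - c + (a * y - x * b) / 2"
  have d1: "deriv (\<lambda>t. n * rpen (t, y, z) q) x = n * (2 * (x - a) - b * ?w)"
    unfolding pq rpen_eq
    by (rule DERIV_imp_deriv) (auto intro!: derivative_eq_intros simp: field_simps)
  have d2: "deriv (\<lambda>t. n * rpen (x, t, z) q) y = n * (2 * (y - b) + a * ?w)"
    unfolding pq rpen_eq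
    by (rule DERIV_imp_deriv) (auto intro!: derivative_eq_intros simp: field_simps)
  have d3: "deriv (\<lambda>t. n * rpen (x, y, t) q) z = n * (2 * ?w)"
    unfolding pq rpen_eq
    by (rule DERIV_imp_deriv) (auto intro!: derivative_eq_intros simp: field_simps)
  show ?thesis
    using d1 d2 d3 unfolding pq
    by (simp only: hgrad_def X1.simps X2.simps) (simp add: Let_def field_simps)
qed

text \<open>The fields \<open>X\<^sub>1, X\<^sub>2\<close> generate right translations, and \<open>p h q\<inverse> = p (q h\<inverse>)\<inverse>\<close>; hence both
  variables see the same horizontal gradient up to sign.\<close>

lemma hgrad_rpen_right: "hgrad (\<lambda>q. - (n * rpen p q)) q = n *\<^sub>R rpen_hgrad p q"
proof -
  obtain x y z a b c where pq: "p = (x, y, z)" "q = (a, b, c)" by (metis surj_pair)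
  let ?w = "z - c + (a * y - x * b) / 2"
  have d1: "deriv (\<lambda>t. - (n * rpen p (t, b, c))) a = n * (2 * (x - a) - y * ?w)"
    unfolding pq rpen_eq
    by (rule DERIV_imp_deriv) (auto intro!: derivative_eq_intros simp: field_simps)
  have d2: "deriv (\<lambda>t. - (n * rpen p (a, t, c))) b = n * (2 * (y - b) + x * ?w)"
    unfolding pq rpen_eq
    by (rule DERIV_imp_deriv) (auto intro!: derivative_eq_intros simp: field_simps)
  have d3: "deriv (\<lambda>t. - (n * rpen p (a, b, t))) c = n * (2 * ?w)"
    unfolding pq rpen_eq
    by (rule DERIV_imp_deriv) (auto intro!: derivative_eq_intros simp: field_simps)
  show ?thesis
    using d1 d2 d3 unfolding pq
    by (simp only: hgrad_def X1.simps X2.simps) (simp add: Let_def field_simps)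
qed

section \<open>Horizontal displacements and their effect on the penalty\<close>

definition hlift :: "real \<times> real \<Rightarrow> heis" where
  "hlift k = (fst k, snd k, 0)"

lemma hplane_iff: "\<xi> \<in> hplane p \<longleftrightarrow> (\<exists>k. \<xi> = p \<cdot>\<^sub>H hlift k)"
  by (auto simp: hplane_def hplane0_def hlift_def image_iff)

lemma hmul_hlift_in_hplane [simp]: "p \<cdot>\<^sub>H hlift k \<in> hplane p"
  unfolding hplane_iff by blast

lemma hpart_hlift [simp]: "hpart (hinv p \<cdot>\<^sub>H (p \<cdot>\<^sub>H hlift k)) = k"
  by (simp flip: hmul_assoc) (simp add: hlift_def)

lemma continuous_on_hlift [continuous_intros]:
  "continuous_on S f \<Longrightarrow> continuous_on S (\<lambda>x. hlift (f x))"
  unfolding hlift_def by (intro continuous_intros)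

text \<open>The point is shifted back along \<open>k\<close> itself, which commutes with \<open>c k\<close>, so no central
  term appears and the slope of the penalty is exactly the gradient paired with \<open>k\<close>.\<close>

lemma rpen_shift:
  "\<exists>C. \<forall>s. rpen (p \<cdot>\<^sub>H hlift ((c - s) *\<^sub>R k)) (q \<cdot>\<^sub>H hlift (c *\<^sub>R k))
     = rpen p q - s * (rpen_hgrad p q \<bullet> k) + C * s\<^sup>2"
proof -
  obtain x y z a b d k1 k2 where pq: "p = (x, y, z)" "q = (a, b, d)" "k = (k1, k2)"
    by (metis surj_pair)
  define w where "w = z - d + (a * y - x * b) / 2"
  \<comment> \<open>The relative position of the shifted points is \<open>p \<cdot>\<^sub>H hlift
    ((- s) *\<^sub>R k) \<cdot>\<^sub>H hinv q\<close>. It is affine in \<open>s\<close>, with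
    vertical coordinate \<open>w - s * r\<close>.\<close>
  define r where "r = ((x + a) * k2 - (y + b) * k1) / 2"
  have "rpen (p \<cdot>\<^sub>H hlift ((c - s) *\<^sub>R k)) (q \<cdot>\<^sub>H hlift (c *\<^sub>R k))
      = rpen p q - s * (rpen_hgrad p q \<bullet> k) + (k1\<^sup>2 + k2\<^sup>2 + r\<^sup>2) * s\<^sup>2" for s
  proof -
    have "rpen (p \<cdot>\<^sub>H hlift ((c - s) *\<^sub>R k)) (q \<cdot>\<^sub>H hlift (c *\<^sub>R k))
        = (x + (c - s) * k1 - (a + c * k1))\<^sup>2 + (y + (c - s) * k2 - (b + c * k2))\<^sup>2
          + (z + (x * ((c - s) * k2) - (c - s) * k1 * y) / 2 - (d + (a * (c * k2) - c * k1 * b) / 2)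
            + ((a + c * k1) * (y + (c - s) * k2) - (x + (c - s) * k1) * (b + c * k2)) / 2)\<^sup>2"
      by (simp only: pq hlift_def fst_conv snd_conv scaleR_Pair real_scaleR_def hmul.simps rpen_eq add_0_right)
    also have "x + (c - s) * k1 - (a + c * k1) = (x - a) - s * k1"
      by (simp add: algebra_simps)
    also have "y + (c - s) * k2 - (b + c * k2) = (y - b) - s * k2"
      by (simp add: algebra_simps)
    also have "z + (x * ((c - s) * k2) - (c - s) * k1 * y) / 2 - (d + (a * (c * k2) - c * k1 * b) / 2)
            + ((a + c * k1) * (y + (c - s) * k2) - (x + (c - s) * k1) * (b + c * k2)) / 2 = w - s * r"
      unfolding w_def r_def by (simp add: field_simps)
    also have "((x - a) - s * k1)\<^sup>2 + ((y - b) - s * k2)\<^sup>2 + (w - s * r)\<^sup>2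
        = (x - a)\<^sup>2 + (y - b)\<^sup>2 + w\<^sup>2 - s * (2 * (x - a) * k1 + 2 * (y - b) * k2 + 2 * r * w)
          + (k1\<^sup>2 + k2\<^sup>2 + r\<^sup>2) * s\<^sup>2"
      by algebra
    also have "(x - a)\<^sup>2 + (y - b)\<^sup>2 + w\<^sup>2 = rpen p q"
      by (simp add: pq rpen_eq w_def)
    also have "2 * (x - a) * k1 + 2 * (y - b) * k2 + 2 * r * w = rpen_hgrad p q \<bullet> k"
      unfolding r_def by (simp add: pq Let_def flip: w_def) (simp add: field_simps)
    finally show ?thesis .
  qed
  then show ?thesis by blast
qed

text \<open>For small positive \<open>s\<close> the linear decrease beats the quadratic remainder.
  Strictness matters, since the subsolution test sees only the strict sublevel set.\<close>

lemma rpen_shift_less: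
  assumes "rpen_hgrad p q \<bullet> k > 0"
  shows "eventually (\<lambda>s. rpen (p \<cdot>\<^sub>H hlift ((c - s) *\<^sub>R k)) (q \<cdot>\<^sub>H hlift (c *\<^sub>R k)) < rpen p q)
    (at_right 0)"
proof -
  obtain C where C: "\<And>s. rpen (p \<cdot>\<^sub>H hlift ((c - s) *\<^sub>R k)) (q \<cdot>\<^sub>H hlift (c *\<^sub>R k))
     = rpen p q - s * (rpen_hgrad p q \<bullet> k) + C * s\<^sup>2"
    using rpen_shift by metis
  have "((\<lambda>s::real. C * s) \<longlongrightarrow> C * 0) (at_right 0)"
    by (intro tendsto_intros)
  then have "eventually (\<lambda>s. C * s < rpen_hgrad p q \<bullet> k) (at_right 0)"
    using assms by (intro order_tendstoD(2)[where y = 0]) auto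
  moreover have "eventually (\<lambda>s::real. s > 0) (at_right 0)"
    by (simp add: eventually_at_right_less)
  ultimately show ?thesis
  proof eventually_elim
    case (elim s)
    then have "s * (C * s) < s * (rpen_hgrad p q \<bullet> k)" by (intro mult_strict_left_mono)
    then show ?case by (simp add: C power2_eq_square mult_ac)
  qed
qed

section \<open>Comparison\<close>

lemma subsolution_test:
  assumes "subsolution \<Omega> f u" "p \<in> \<Omega>" "C1_on \<Omega> \<phi>" "\<forall>p'\<in>\<Omega>. u p' - \<phi> p' \<le> u p - \<phi> p"
  shows "ereal (u p) + (if hgrad \<phi> p = 0 then 0
      else SUP \<xi>\<in>sublevel_strict \<Omega> u p. ereal (hgrad \<phi> p \<bullet> hpart (hinv p \<cdot>\<^sub>H \<xi>))) \<le> ereal (f p)"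
  using assms unfolding subsolution_def by blast

text \<open>The factor \<open>c\<close> merges two uses: \<open>c = 1\<close> carries a point of the
  sublevel set of \<open>v\<close> over to \<open>p\<close>, while \<open>c = 0\<close> only moves
  from \<open>p\<close> along \<open>- k\<close> and yields \<open>u p \<le> f p\<close>.\<close>

lemma subsolution_shift:
  assumes \<Omega>: "open \<Omega>" and sub: "subsolution \<Omega> f u" and n: "n > 0"
    and p: "p \<in> \<Omega>" and \<xi>: "q \<cdot>\<^sub>H hlift (c *\<^sub>R k) \<in> \<Omega>" "v (q \<cdot>\<^sub>H hlift (c *\<^sub>R k)) \<le> v q"
    and p\<xi>: "p \<cdot>\<^sub>H hlift (c *\<^sub>R k) \<in> \<Omega>"
    and q: "q \<in> \<Omega>"
    and max: "\<And>p' q'. p' \<in> \<Omega> \<Longrightarrow> q' \<in> \<Omega> \<Longrightarrow>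
      u p' - v q' - n * rpen p' q' \<le> u p - v q - n * rpen p q"
    and pos: "rpen_hgrad p q \<bullet> k > 0"
  shows "u p + c * (n * (rpen_hgrad p q \<bullet> k)) \<le> f p"
proof -
  let ?\<phi> = "\<lambda>p. n * rpen p q"
  have grad: "hgrad ?\<phi> p = n *\<^sub>R rpen_hgrad p q" by (rule hgrad_rpen_left)
  have "\<forall>p'\<in>\<Omega>. u p' - ?\<phi> p' \<le> u p - ?\<phi> p"
    using max[OF _ q] by fastforce
  note subsolution_test[OF sub p C1_on_rpen_left this]
  moreover have "hgrad ?\<phi> p \<noteq> 0" using pos n by (auto simp: grad)
  ultimately have sup: "ereal (u p) + (SUP \<xi>\<in>sublevel_strict \<Omega> u p.
      ereal (hgrad ?\<phi> p \<bullet> hpart (hinv p \<cdot>\<^sub>H \<xi>))) \<le> ereal (f p)"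
    by (simp only: if_False)
  \<comment> \<open>Each point of the strict sublevel set bounds the supremum from below, which
    turns the extended-real inequality into a real one.\<close>
  have le: "u p + n * (rpen_hgrad p q \<bullet> h) \<le> f p" if "p \<cdot>\<^sub>H hlift h \<in> \<Omega>" "u (p \<cdot>\<^sub>H hlift h) < u p" for h
  proof -
    have "p \<cdot>\<^sub>H hlift h \<in> sublevel_strict \<Omega> u p"
      using that by (simp add: sublevel_strict_def)
    then have "ereal (hgrad ?\<phi> p \<bullet> hpart (hinv p \<cdot>\<^sub>H (p \<cdot>\<^sub>H hlift h)))
        \<le> (SUP \<xi>\<in>sublevel_strict \<Omega> u p. ereal (hgrad ?\<phi> p \<bullet> hpart (hinv p \<cdot>\<^sub>H \<xi>)))"
      by (rule SUP_upper)
    then have "ereal (u p) + ereal (n * (rpen_hgrad p q \<bullet> h)) \<le> ereal (u p) +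
        (SUP \<xi>\<in>sublevel_strict \<Omega> u p. ereal (hgrad ?\<phi> p \<bullet> hpart (hinv p \<cdot>\<^sub>H \<xi>)))"
      by (intro add_left_mono) (simp add: grad)
    also have "\<dots> \<le> ereal (f p)" by (rule sup)
    finally show ?thesis by simp
  qed
  have "continuous_on UNIV (\<lambda>s. p \<cdot>\<^sub>H hlift ((c - s) *\<^sub>R k))"
    by (intro continuous_intros)
  then have "(\<lambda>s. p \<cdot>\<^sub>H hlift ((c - s) *\<^sub>R k)) \<midarrow>0\<rightarrow> p \<cdot>\<^sub>H hlift ((c - 0) *\<^sub>R k)"
    unfolding continuous_on_def by blast
  then have "((\<lambda>s. p \<cdot>\<^sub>H hlift ((c - s) *\<^sub>R k)) \<longlongrightarrow> p \<cdot>\<^sub>H hlift (c *\<^sub>R k)) (at_right 0)"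
    by (simp add: filterlim_at_split)
  then have "eventually (\<lambda>s. p \<cdot>\<^sub>H hlift ((c - s) *\<^sub>R k) \<in> \<Omega>) (at_right 0)"
    using \<Omega> p\<xi> by (rule topological_tendstoD)
  with rpen_shift_less[OF pos, of c]
  have ev: "eventually (\<lambda>s. u p + n * (rpen_hgrad p q \<bullet> ((c - s) *\<^sub>R k)) \<le> f p) (at_right 0)"
  proof eventually_elim
    case (elim s)
    have "n * rpen (p \<cdot>\<^sub>H hlift ((c - s) *\<^sub>R k)) (q \<cdot>\<^sub>H hlift (c *\<^sub>R k)) < n * rpen p q"
      using elim n by simp
    \<comment> \<open>With a smaller penalty and no larger \<open>v\<close>, maximality forces a
      smaller \<open>u\<close>.\<close>
    with max[OF elim(2) \<xi>(1)] \<xi>(2) have "u (p \<cdot>\<^sub>H hlift ((c - s) *\<^sub>R k)) < u p"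
      by linarith
    with elim(2) show ?case by (rule le)
  qed
  \<comment> \<open>The strict decrease is known only for small \<open>s > 0\<close>, but the bound
    is continuous in \<open>s\<close> and passes to the limit.\<close>
  have "((\<lambda>s. u p + n * (rpen_hgrad p q \<bullet> ((c - s) *\<^sub>R k))) \<longlongrightarrow>
      u p + n * (rpen_hgrad p q \<bullet> ((c - 0) *\<^sub>R k))) (at_right 0)"
    by (intro tendsto_intros)
  then have "u p + n * (rpen_hgrad p q \<bullet> ((c - 0) *\<^sub>R k)) \<le> f p"
    using ev by (rule tendsto_upperbound) simp
  then show ?thesis by (simp add: mult_ac)
qed

text \<open>With \<open>a = rpen_hgrad p q\<close>, one vector \<open>h\<close> serves both tests in
  the main case: \<open>f q - e < v q + n * (a \<bullet> h)\<close> and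
  \<open>u p + n * (a \<bullet> h) \<le> f p\<close>. Subtracting cancels the gradient terms. The
  assumption \<open>trans\<close> keeps the shifted point in \<open>\<Omega>\<close>.\<close>

lemma penalized_max_le:
  assumes \<Omega>: "open \<Omega>" and sub: "subsolution \<Omega> f u" and super: "supersolution \<Omega> f v"
    and n: "n > 0" and p: "p \<in> \<Omega>" and q: "q \<in> \<Omega>"
    and max: "\<And>p' q'. p' \<in> \<Omega> \<Longrightarrow> q' \<in> \<Omega> \<Longrightarrow>
      u p' - v q' - n * rpen p' q' \<le> u p - v q - n * rpen p q"
    and trans: "\<And>\<xi>. \<xi> \<in> \<Omega> \<Longrightarrow> v \<xi> \<le> v q \<Longrightarrow> (p \<cdot>\<^sub>H hinv q) \<cdot>\<^sub>H \<xi> \<in> \<Omega>"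
  shows "u p - v q \<le> f p - f q"
proof (rule field_le_epsilon)
  fix e :: real assume e: "e > 0"
  let ?a = "rpen_hgrad p q"
  let ?\<psi> = "\<lambda>q. - (n * rpen p q)"
  have "C1_on \<Omega> ?\<psi>" by (rule C1_on_rpen_right)
  moreover have "\<forall>q'\<in>\<Omega>. v q - ?\<psi> q \<le> v q' - ?\<psi> q'"
    using max[OF p] by fastforce
  ultimately have sup: "ereal (f q) \<le> ereal (v q) + (SUP \<xi>\<in>sublevel \<Omega> v q.
      ereal (hgrad ?\<psi> q \<bullet> hpart (hinv q \<cdot>\<^sub>H \<xi>)))"
    using super q unfolding supersolution_def by blast
  \<comment> \<open>The supremum need not be attained, hence the loss \<open>e\<close>.\<close>
  have "\<exists>\<xi>\<in>sublevel \<Omega> v q. f q - e < v q + hgrad ?\<psi> q \<bullet> hpart (hinv q \<cdot>\<^sub>H \<xi>)"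
  proof (rule ccontr)
    assume "\<not> ?thesis"
    then have "(SUP \<xi>\<in>sublevel \<Omega> v q. ereal (hgrad ?\<psi> q \<bullet> hpart (hinv q \<cdot>\<^sub>H \<xi>)))
        \<le> ereal (f q - e - v q)"
      by (intro SUP_least) (auto simp: not_less algebra_simps)
    then have "ereal (f q) \<le> ereal (v q) + ereal (f q - e - v q)"
      using sup add_left_mono order_trans by blast
    then show False using e by simp
  qed
  then obtain h where h: "q \<cdot>\<^sub>H hlift h \<in> \<Omega>" "v (q \<cdot>\<^sub>H hlift h) \<le> v q"
      "f q - e < v q + n * (?a \<bullet> h)"
    by (auto simp: sublevel_def hplane_iff hgrad_rpen_right)
  \<comment> \<open>In the second alternative the gradient term is nonpositive, so
    \<open>f q - e < v q\<close> follows from the supersolution test alone.\<close>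
  have "u p + n * (?a \<bullet> h) \<le> f p \<or> u p \<le> f p \<and> ?a \<bullet> h \<le> 0"
  proof (cases "?a \<bullet> h > 0")
    case True
    have "p \<cdot>\<^sub>H hlift h = (p \<cdot>\<^sub>H hinv q) \<cdot>\<^sub>H (q \<cdot>\<^sub>H hlift h)"
      by (metis hmul_assoc hmul_hinv(1) hmul_zero(1))
    then have "p \<cdot>\<^sub>H hlift h \<in> \<Omega>" using trans[OF h(1,2)] by simp
    then show ?thesis
      using subsolution_shift[OF \<Omega> sub n p, of q 1 h v] h q max True by simp
  next
    case False
    have "u p \<le> f p"
    proof (cases "?a = 0")
      case True
      \<comment> \<open>With zero gradient the supremum counts as \<open>0\<close>, which leaves
        \<open>u p \<le> f p\<close>.\<close>
      have "hgrad (\<lambda>p. n * rpen p q) p = 0" by (simp add: hgrad_rpen_left True)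
      moreover have "\<forall>p'\<in>\<Omega>. u p' - n * rpen p' q \<le> u p - n * rpen p q"
        using max[OF _ q] by fastforce
      note subsolution_test[OF sub p C1_on_rpen_left this]
      ultimately have "ereal (u p) + 0 \<le> ereal (f p)" by (simp only: if_True simp_thms)
      then show ?thesis by simp
    next
      case False
      \<comment> \<open>The choice \<open>c = 0\<close>, \<open>k = ?a\<close> keeps the second
        point at \<open>q\<close>, and \<open>?a \<bullet> ?a > 0\<close>.\<close>
      have "hlift 0 = 0" by (simp add: hlift_def zero_prod_def)
      then show ?thesis
        using subsolution_shift[OF \<Omega> sub n p, of q 0 ?a v] p q max False by simp
    qed
    then show ?thesis using False by simp
  qed
  moreover have "n * (?a \<bullet> h) \<le> 0" if "?a \<bullet> h \<le> 0"
    using n that by (simp add: mult_le_0_iff)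
  ultimately show "u p - v q \<le> f p - f q + e" using h(3) by linarith
qed

section \<open>Compact sublevel sets and small left translations\<close>

lemma compact_lsc_sublevel:
  fixes v :: "'a::metric_space \<Rightarrow> real"
  assumes S: "compact S" and v: "lsc_on S v"
  shows "compact {\<xi>\<in>S. v \<xi> \<le> c}"
proof -
  have "closed {\<xi>\<in>S. v \<xi> \<le> c}"
    unfolding closed_sequential_limits
  proof (intro allI impI, elim conjE)
    fix X l assume X: "\<forall>n. X n \<in> {\<xi>\<in>S. v \<xi> \<le> c}" and l: "X \<longlonglongrightarrow> l"
    have lS: "l \<in> S"
      using compact_imp_closed[OF S] X l unfolding closed_sequential_limits by blast
    have "v l \<le> c"
    proof (rule ccontr)
      assume "\<not> v l \<le> c"
      then have "eventually (\<lambda>n. - v (X n) < - c) sequentially"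
        using v lS l X by (intro usc_on_filterlim[of S "\<lambda>p. - v p" l])
          (auto simp: lsc_on_iff_usc_on_uminus)
      then show False using X by (auto simp: not_less[symmetric] dest: eventually_happens)
    qed
    with lS show "l \<in> {\<xi>\<in>S. v \<xi> \<le> c}" by simp
  qed
  then have "compact (S \<inter> {\<xi>\<in>S. v \<xi> \<le> c})" by (rule compact_Int_closed[OF S])
  then show ?thesis by (simp add: Int_def conj_ac)
qed

text \<open>The preimage of \<open>\<Omega>\<close> under multiplication is open and contains
  \<open>{0} \<times> D\<close>; by the tube lemma one neighbourhood of \<open>0\<close> works for
  all of the compact set \<open>D\<close>.\<close>

lemma eventually_translate_in_open:
  assumes D: "compact D" and \<Omega>: "open \<Omega>" "D \<subseteq> \<Omega>"
  shows "eventually (\<lambda>w. \<forall>\<xi>\<in>D. w \<cdot>\<^sub>H \<xi> \<in> \<Omega>) (nhds 0)"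
proof -
  let ?W = "(\<lambda>x. fst x \<cdot>\<^sub>H snd x) -` \<Omega>"
  have W: "open ?W"
    by (intro open_vimage \<Omega>(1) continuous_intros)
  have "{0} \<times> D \<subseteq> ?W"
  proof (rule subsetI, erule SigmaE)
    fix x w \<xi> assume "w \<in> {0::heis}" "\<xi> \<in> D" "x = (w, \<xi>)"
    then show "x \<in> ?W" using \<Omega>(2) by (simp add: subsetD)
  qed
  from Elementary_Topology.tube_lemma[OF D W this]
  obtain A where A: "open A" "0 \<in> A" "A \<times> D \<subseteq> ?W" by blast
  have "\<forall>w\<in>A. \<forall>\<xi>\<in>D. w \<cdot>\<^sub>H \<xi> \<in> \<Omega>"
  proof (intro ballI)
    fix w \<xi> assume "w \<in> A" "\<xi> \<in> D"
    then have "(w, \<xi>) \<in> ?W" using A(3) by blast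
    then show "w \<cdot>\<^sub>H \<xi> \<in> \<Omega>" by (simp only: vimage_eq fst_conv snd_conv)
  qed
  with A(1,2) show ?thesis unfolding eventually_nhds by blast
qed

theorem theorem3p5:
  fixes \<Omega> :: "heis set" and f u v :: "heis \<Rightarrow> real" and K :: real
  assumes "open \<Omega>" and "connected \<Omega>" and "bounded \<Omega>"
    and "continuous_on \<Omega> f"
    and "usc_on (closure \<Omega>) u" and "lsc_on (closure \<Omega>) v"
    and "subsolution \<Omega> f u" and "supersolution \<Omega> f v"
    and "\<forall>p\<in>frontier \<Omega>. u p \<le> v p \<and> v p = K"
    and "\<forall>p\<in>closure \<Omega>. u p \<le> K"
  shows "\<forall>p\<in>closure \<Omega>. u p \<le> v p"
proof (rule ccontr)
  assume "\<not> ?thesis"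
  then obtain p0 where p0: "p0 \<in> closure \<Omega>" "u p0 > v p0" by force
  define M where "M = u p0 - v p0"
  have M: "M > 0" using p0 by (simp add: M_def)
  let ?S = "closure \<Omega>"
  have S: "compact ?S" using \<open>bounded \<Omega>\<close> by (simp add: compact_closure)
  have frontier: "p \<in> \<Omega>" if "p \<in> ?S" "p \<notin> frontier \<Omega>" for p
    using that \<open>open \<Omega>\<close> by (simp add: frontier_def interior_open)
  have sub_S: "p \<in> ?S" if "p \<in> \<Omega>" for p using that closure_subset by blast
  have cont: "continuous_on UNIV (\<lambda>x. c * rpen (fst x) (snd x))" for c
    unfolding rpen_def by (intro continuous_intros)

  \<comment> \<open>The minimum of \<open>v\<close>, together with \<open>u \<le> K\<close>, bounds
    \<open>u p - v q\<close> by \<open>K - v q0\<close> independently of \<open>n\<close>.\<close>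
  obtain q0 where q0: "q0 \<in> ?S" "\<And>q. q \<in> ?S \<Longrightarrow> v q0 \<le> v q"
    using usc_on_attains_max[OF S _ assms(6)[unfolded lsc_on_iff_usc_on_uminus]] p0(1)
    by (metis empty_iff neg_le_iff_le)

  define \<Phi> where "\<Phi> n x = u (fst x) - v (snd x) - real (Suc n) * rpen (fst x) (snd x)" for n x
  have "\<exists>x\<in>?S \<times> ?S. \<forall>y\<in>?S \<times> ?S. \<Phi> n y \<le> \<Phi> n x" for n
    unfolding \<Phi>_def using S p0 assms(5,6) cont
    by (intro usc_on_attains_max usc_on_diff_penalty[where g = "\<lambda>p q. real (Suc n) * rpen p q"])
      (auto simp del: of_nat_Suc intro: compact_Times)
  then obtain X where X: "\<And>n. X n \<in> ?S \<times> ?S" "\<And>n y. y \<in> ?S \<times> ?S \<Longrightarrow> \<Phi> n y \<le> \<Phi> n (X n)"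
    by metis
  have X_S: "fst (X n) \<in> ?S" "snd (X n) \<in> ?S" for n
    using X(1)[of n] by auto
  \<comment> \<open>Comparison with the diagonal point \<open>(p0, p0)\<close>, where the penalty
    vanishes.\<close>
  have ge_M: "M + real (Suc n) * rpen (fst (X n)) (snd (X n)) \<le> u (fst (X n)) - v (snd (X n))" for n
    using X(2)[of "(p0, p0)" n] p0 by (simp add: \<Phi>_def M_def del: of_nat_Suc)
  have rpen_ge: "rpen p q \<ge> 0" for p q by (simp add: rpen_def)

  obtain r l where r: "strict_mono r" and l: "l \<in> ?S \<times> ?S" "(X \<circ> r) \<longlonglongrightarrow> l"
    using compact_Times[OF S S] X(1) unfolding compact_def by metis
  define p q where "p n = fst (X (r n))" and "q n = snd (X (r n))" for n
  have lim: "p \<longlonglongrightarrow> fst l" "q \<longlonglongrightarrow> snd l"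
    using tendsto_fst[OF l(2)] tendsto_snd[OF l(2)] by (simp_all add: p_def[abs_def] q_def[abs_def] comp_def)

  have cont_lim: "(\<lambda>n. g (p n) (q n)) \<longlonglongrightarrow> g (fst l) (snd l)"
    if "continuous_on UNIV (\<lambda>x. g (fst x) (snd x))" for g :: "heis \<Rightarrow> heis \<Rightarrow> 'b::topological_space"
    using continuous_on_tendsto_compose[OF that l(2)] by (simp add: p_def q_def)
  \<comment> \<open>The weighted penalty stays below \<open>K - v q0\<close> while the weights tend
    to infinity, so the limit lies on the diagonal.\<close>
  have "rpen (fst l) (snd l) \<le> 0"
  proof (rule tendsto_le[OF _ _ cont_lim[of rpen]])
    show "(\<lambda>n. (K - v q0) * inverse (real (Suc (r n)))) \<longlonglongrightarrow> 0"
      using tendsto_mult_left[OF LIMSEQ_subseq_LIMSEQ[OF LIMSEQ_inverse_real_of_nat r], of "K - v q0"]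
      by (simp add: comp_def del: of_nat_Suc)
    have "rpen (p n) (q n) \<le> (K - v q0) * inverse (real (Suc (r n)))" for n
    proof -
      have "real (Suc (r n)) * rpen (p n) (q n) \<le> K - v q0"
        using ge_M[of "r n"] M X_S[of "r n"] q0(2)[of "q n"] assms(10)
        unfolding p_def q_def by fastforce
      then show ?thesis by (simp add: field_simps del: of_nat_Suc)
    qed
    then show "eventually (\<lambda>n. rpen (p n) (q n) \<le> (K - v q0) * inverse (real (Suc (r n)))) sequentially"
      by simp
    show "continuous_on UNIV (\<lambda>x. rpen (fst x) (snd x))" using cont[of 1] by simp
  qed simp
  then have "fst l \<cdot>\<^sub>H hinv (snd l) = 0" by (simp add: rpen_def)
  then have diag: "fst l = snd l"
    by (metis hmul_assoc hmul_hinv(1) hmul_zero)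
  have lS: "snd l \<in> ?S" using l(1) by auto

  \<comment> \<open>Semicontinuity, applied with zero penalty, carries the excess \<open>M\<close>
    to the limit, which therefore cannot lie on the frontier, where
    \<open>u \<le> v\<close>.\<close>
  have "u (snd l) - v (snd l) \<ge> M"
  proof (rule ccontr)
    assume "\<not> ?thesis"
    then have "eventually (\<lambda>n. u (fst (X (r n))) - v (snd (X (r n))) - 0 < M) sequentially"
      using usc_on_filterlim[OF usc_on_diff_penalty[OF assms(5,6), of "\<lambda>_ _. 0"] l(1), of M "X \<circ> r" sequentially]
        l(2) X(1) diag by simp
    then obtain n where "u (fst (X (r n))) - v (snd (X (r n))) - 0 < M"
      by (auto dest: eventually_happens)
    moreover have "real (Suc (r n)) * rpen (fst (X (r n))) (snd (X (r n))) \<ge> 0"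
      by (intro mult_nonneg_nonneg rpen_ge) simp
    ultimately show False using ge_M[of "r n"] by linarith
  qed
  then have "\<not> u (snd l) \<le> v (snd l)" using M by linarith
  then have l\<Omega>: "snd l \<in> \<Omega>" using lS assms(9) frontier by blast
  have f_lim: "(\<lambda>n. f (p n) - f (q n)) \<longlonglongrightarrow> f (snd l) - f (snd l)"
    using assms(1,4) l\<Omega> lim diag
    by (intro tendsto_diff isCont_tendsto_compose[of _ f]) (auto simp: continuous_on_eq_continuous_at)

  \<comment> \<open>Since \<open>u \<le> K\<close> and \<open>u (p n) - v (q n) \<ge> M\<close>, the
    sublevel sets of \<open>v\<close> at the levels \<open>v (q n)\<close> all lie in this one set.
    It avoids the frontier because \<open>v = K\<close> there.\<close>
  define D where "D = {\<xi>\<in>?S. v \<xi> \<le> K - M}"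
  have "compact D" unfolding D_def by (intro compact_lsc_sublevel S assms(6))
  moreover have "D \<subseteq> \<Omega>"
  proof
    fix \<xi> assume "\<xi> \<in> D"
    then have "\<xi> \<in> ?S" "v \<xi> \<noteq> K" using M by (simp_all add: D_def)
    then show "\<xi> \<in> \<Omega>" using assms(9) frontier by blast
  qed
  ultimately have "eventually (\<lambda>w. \<forall>\<xi>\<in>D. w \<cdot>\<^sub>H \<xi> \<in> \<Omega>) (nhds 0)"
    using assms(1) by (intro eventually_translate_in_open)
  moreover have "(\<lambda>n. p n \<cdot>\<^sub>H hinv (q n)) \<longlonglongrightarrow> 0"
    using cont_lim[of "\<lambda>p q. p \<cdot>\<^sub>H hinv q"] diag by (simp add: continuous_intros)
  ultimately have "eventually (\<lambda>n. \<forall>\<xi>\<in>D. p n \<cdot>\<^sub>H hinv (q n) \<cdot>\<^sub>H \<xi> \<in> \<Omega>) sequentially"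
    by (rule eventually_compose_filterlim)
  moreover have "eventually (\<lambda>n. p n \<in> \<Omega>) sequentially" "eventually (\<lambda>n. q n \<in> \<Omega>) sequentially"
    using lim l\<Omega> diag assms(1) by (auto intro: topological_tendstoD)
  moreover have "eventually (\<lambda>n. f (p n) - f (q n) < M) sequentially"
    using f_lim M by (intro order_tendstoD(2)) auto
  ultimately have "eventually (\<lambda>n. False) sequentially"
  proof eventually_elim
    case (elim n)
    have pq: "p n \<in> ?S" "q n \<in> ?S" using X_S by (auto simp: p_def q_def)
    have "real (Suc (r n)) * rpen (p n) (q n) \<ge> 0"
      by (intro mult_nonneg_nonneg rpen_ge) simp
    then have M_le: "M \<le> u (p n) - v (q n)"
      using ge_M[of "r n"] by (simp add: p_def q_def del: of_nat_Suc)
    have "u (p n) - v (q n) \<le> f (p n) - f (q n)"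
    proof (rule penalized_max_le[OF assms(1,7,8) _ elim(2,3)])
      show "real (Suc (r n)) > 0" by simp
      show "u p' - v q' - real (Suc (r n)) * rpen p' q'
          \<le> u (p n) - v (q n) - real (Suc (r n)) * rpen (p n) (q n)" if "p' \<in> \<Omega>" "q' \<in> \<Omega>" for p' q'
        using X(2)[of "(p', q')" "r n"] that sub_S by (simp add: \<Phi>_def p_def q_def del: of_nat_Suc)
      show "p n \<cdot>\<^sub>H hinv (q n) \<cdot>\<^sub>H \<xi> \<in> \<Omega>" if "\<xi> \<in> \<Omega>" "v \<xi> \<le> v (q n)" for \<xi>
      proof -
        have "u (p n) \<le> K" using assms(10) pq(1) by blast
        with that sub_S M_le have "\<xi> \<in> D" by (simp add: D_def)
        with elim(1) show ?thesis by blast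
      qed
    qed
    \<comment> \<open>Altogether
      \<open>M \<le> u (p n) - v (q n) \<le> f (p n) - f (q n) < M\<close>.\<close>
    with M_le elim(4) show False by simp
  qed
  then show False by simp
qed

end
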